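(* Let $\sigma$ be a primitive self-similar substitution in $\mathbb{R}^2$ and let $\mathcal{T}$ be a substitution tiling with respect to $\sigma$ that is of statistical circular symmetry. Then for every $\varepsilon>0$ and each finite patch $P\subset\mathcal{T}$ there is $r>0$ such that every ball of radius $r$ contains a translate of $P$ up to a small rotation; that is, for every $x\in\mathbb{R}^2$ there are $\alpha\in\mathbb{R}$ with $|\alpha|<\varepsilon$ and $t\in\mathbb{R}^2$ such that $R_\alpha P+t\subset\mathcal{T}$ and all tiles of $R_\alpha P+t$ lie in $B_r(x)$.
   Context: Identify $\mathbb{R}^2$ with $\mathbb{C}$. $R_\alpha$ is the rotation through the angle $\alpha$ about the origin, a bar denotes reflection in the horizontal axis, and $B_r(x)$ is the closed ball of radius $r$ around $x$. A tiling of $\mathbb{R}^2$ is a covering of $\mathbb{R}^2$ by compact sets (tiles) with nonempty interior which is also a packing (distinct tiles have disjoint interiors). Prototiles, copies, orientation. Fix finitely many prototiles $T_1,\dots,T_m\subset\mathbb{R}^2$. A copy of $T_i$ is a tile of the form $R_\alpha T_i+t$ or (reflected copy) $R_\alpha\overline{T_i}+t$ with $\alpha\in[0,2\pi)$, $t\in\mathbb{R}^2$. Such a tile $T$ is said to be of type $i$ and has angle $\alpha(T)=\alpha\in[0,2\pi)$. If a prototile has nontrivial symmetries, or two prototiles are congruent, tiles are understood to carry labels or markings, so that the type, the chirality (reflected or not) and the angle of each tile are well defined; rigid motions, and congruence of sets of tiles, respect these markings. Substitution. A self-similar substitution $\sigma$ with substitution factor $\lambda>1$ assigns to each prototile $T_i$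 a finite set $\sigma(T_i)$ of copies of prototiles with pairwise disjoint interiors such that $\lambda T_i=\bigcup_{T\in\sigma(T_i)}T$. It is extended to copies by $\sigma(R_\alpha T_i+t)=R_\alpha\sigma(T_i)+\lambda t$ and $\sigma(R_\alpha\overline{T_i}+t)=R_\alpha\overline{\sigma(T_i)}+\lambda t$, and to sets of copies by taking unions; so $\sigma^n(T_i)$ is defined for all $n\ge 1$. The substitution matrix is the $m\times m$ matrix whose entries count the tiles of type $j$ in $\sigma(T_i)$, $1\le i,j\le m$; $\sigma$ is primitive if some power of this matrix has only positive entries. Substitution tilings. A patch of a tiling is a finite subset of it. A tiling $\mathcal{T}$ by copies of the prototiles is a substitution tiling (with respect to $\sigma$) if each patch in $\mathcal{T}$ is congruent to a patch in $\sigma^n(T_i)$ for some $n$ and $i$. Statistical circular symmetry. Let $\mathcal{T}$ be a substitution tiling with respect to a primitive $\sigma$, and enumerate the tiles of $\mathcal{T}$ as a sequence $(S_j)_{j\ge1}$ in order of non-decreasing distance from the origin (ties broken arbitrarily). $\mathcal{T}$ is of statistical circular symmetry if for all $0\le x<y<2\pi$, $$\lim_{n\to\infty}\frac1n\sum_{j=1}^n 1_{[x,y]}(\alpha(S_j))=\frac{y-x}{2\pi}.$$ *)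

theory Defs
  imports "HOL-Analysis.Analysis" "HOL-Library.Real_Mod"
begin

text \<open>
  The plane is the type of complex numbers, and the prototiles are a family
  \<open>T :: 'm \<Rightarrow> complex set\<close> indexed by a finite type. Tiles are labelled:
  \<open>Tile i c \<alpha> t\<close> stands for the copy $R_\alpha T_i + t$ (if \<open>c\<close> is false) or
  $R_\alpha \overline{T_i} + t$ (if \<open>c\<close> is true), so that type, chirality and angle are
  well defined even for symmetric or mutually congruent prototiles. The underlying compact
  set is \<open>support T \<tau>\<close>; together with the labels it determines the translation vector.
\<close>

datatype 'm tile =
  Tile (tile_type: 'm) (reflected: bool) (tile_angle: real) (tile_shift: complex)

definition support :: "('m \<Rightarrow> complex set) \<Rightarrow> 'm tile \<Rightarrow> complex set" where
  "support T \<tau> =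
     (\<lambda>z. cis (tile_angle \<tau>) * z + tile_shift \<tau>) `
       (if reflected \<tau> then cnj ` T (tile_type \<tau>) else T (tile_type \<tau>))"

definition copies :: "'m tile set" where
  "copies = {\<tau>. 0 \<le> tile_angle \<tau> \<and> tile_angle \<tau> < 2 * pi}"

definition prototiles :: "('m \<Rightarrow> complex set) \<Rightarrow> bool" where
  "prototiles T \<longleftrightarrow> (\<forall>i. compact (T i) \<and> interior (T i) \<noteq> {})"

text \<open>
  The action of isometries on labelled tiles: \<open>move \<beta> s\<close> is $X \mapsto R_\beta X + s$, and
  \<open>mirror\<close> is $X \mapsto \overline X$. Angles are normalised to $[0,2\pi)$. Note that
  $\overline{R_\alpha T_i + t} = R_{-\alpha} \overline{T_i} + \overline t$.
\<close>

definition move :: "real \<Rightarrow> complex \<Rightarrow> 'm tile \<Rightarrow> 'm tile" where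
  "move \<beta> s \<tau> =
     Tile (tile_type \<tau>) (reflected \<tau>) ((tile_angle \<tau> + \<beta>) rmod (2 * pi)) (cis \<beta> * tile_shift \<tau> + s)"

definition mirror :: "'m tile \<Rightarrow> 'm tile" where
  "mirror \<tau> =
     Tile (tile_type \<tau>) (\<not> reflected \<tau>) ((- tile_angle \<tau>) rmod (2 * pi)) (cnj (tile_shift \<tau>))"

lemma cis_rmod_2pi: "cis (x rmod (2 * pi)) = cis x"
proof -
  have "cis x = cis (x rmod (2 * pi) + 2 * pi * of_int \<lfloor>x / (2 * pi)\<rfloor>)"
    by (simp add: rmod_def)
  also have "\<dots> = cis (x rmod (2 * pi))"
    by (simp add: cis_mult [symmetric] cis_multiple_2pi)
  finally show ?thesis ..
qed

lemma support_move: "support T (move \<beta> s \<tau>) = (\<lambda>z. cis \<beta> * z + s) ` support T \<tau>"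
  unfolding support_def move_def tile.sel cis_rmod_2pi cis_mult [symmetric]
  by (simp add: image_image algebra_simps)

lemma support_mirror: "support T (mirror \<tau>) = cnj ` support T \<tau>"
  by (simp add: support_def mirror_def cis_rmod_2pi image_image cis_cnj)

lemma move_in_copies: "move \<beta> s \<tau> \<in> copies"
  by (simp add: copies_def move_def rmod_nonneg rmod_less)

lemma mirror_in_copies: "mirror \<tau> \<in> copies"
  by (simp add: copies_def mirror_def rmod_nonneg rmod_less)

text \<open>Congruent means equal up to an isometry of the plane, orientation reversing ones included.\<close>

definition congruent_tiles :: "'m tile set \<Rightarrow> 'm tile set \<Rightarrow> bool" where
  "congruent_tiles P Q \<longleftrightarrow> (\<exists>\<beta> s. Q = move \<beta> s ` P \<or> Q = move \<beta> s ` mirror ` P)"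

definition packing :: "('m \<Rightarrow> complex set) \<Rightarrow> 'm tile set \<Rightarrow> bool" where
  "packing T X \<longleftrightarrow>
     (\<forall>\<tau>\<in>X. \<forall>\<tau>'\<in>X. \<tau> \<noteq> \<tau>' \<longrightarrow> interior (support T \<tau>) \<inter> interior (support T \<tau>') = {})"

definition tiling :: "('m \<Rightarrow> complex set) \<Rightarrow> 'm tile set \<Rightarrow> bool" where
  "tiling T X \<longleftrightarrow> X \<subseteq> copies \<and> (\<Union>\<tau>\<in>X. support T \<tau>) = UNIV \<and> packing T X"

definition patch :: "'m tile set \<Rightarrow> 'm tile set \<Rightarrow> bool" where
  "patch P X \<longleftrightarrow> finite P \<and> P \<subseteq> X"

text \<open>The substitution is the map \<open>\<sigma>\<close> on the types, with \<open>\<sigma> i\<close> being $\sigma(T_i)$.\<close>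

definition self_similar_substitution ::
    "('m \<Rightarrow> complex set) \<Rightarrow> real \<Rightarrow> ('m \<Rightarrow> 'm tile set) \<Rightarrow> bool" where
  "self_similar_substitution T lam \<sigma> \<longleftrightarrow>
     lam > 1 \<and>
     (\<forall>i. finite (\<sigma> i) \<and> \<sigma> i \<subseteq> copies \<and> packing T (\<sigma> i) \<and>
          (\<lambda>z. of_real lam * z) ` T i = (\<Union>\<tau>\<in>\<sigma> i. support T \<tau>))"

definition subst_tile :: "real \<Rightarrow> ('m \<Rightarrow> 'm tile set) \<Rightarrow> 'm tile \<Rightarrow> 'm tile set" where
  "subst_tile lam \<sigma> \<tau> =
     move (tile_angle \<tau>) (of_real lam * tile_shift \<tau>) `
       (if reflected \<tau> then mirror ` \<sigma> (tile_type \<tau>) else \<sigma> (tile_type \<tau>))"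

definition subst_set :: "real \<Rightarrow> ('m \<Rightarrow> 'm tile set) \<Rightarrow> 'm tile set \<Rightarrow> 'm tile set" where
  "subst_set lam \<sigma> X = (\<Union>\<tau>\<in>X. subst_tile lam \<sigma> \<tau>)"

text \<open>$\sigma^n(T_i)$, starting from the prototile itself as an unrotated copy.\<close>

definition subst_iter :: "real \<Rightarrow> ('m \<Rightarrow> 'm tile set) \<Rightarrow> nat \<Rightarrow> 'm \<Rightarrow> 'm tile set" where
  "subst_iter lam \<sigma> n i = (subst_set lam \<sigma> ^^ n) {Tile i False 0 0}"

lemma subst_iter_1:
  assumes "self_similar_substitution T lam \<sigma>"
  shows "subst_iter lam \<sigma> 1 i = \<sigma> i"
proof -
  have "move 0 0 \<tau> = \<tau>" if "\<tau> \<in> \<sigma> i" for \<tau>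
  proof -
    have "0 \<le> tile_angle \<tau>" "tile_angle \<tau> < 2 * pi"
      using that assms by (auto simp: self_similar_substitution_def copies_def)
    hence "tile_angle \<tau> rmod (2 * pi) = tile_angle \<tau>"
      by (intro rmod_idem) auto
    thus ?thesis by (simp add: move_def)
  qed
  thus ?thesis
    by (simp add: subst_iter_def subst_set_def subst_tile_def)
qed

lemma support_subst_tile:
  assumes "self_similar_substitution T lam \<sigma>"
  shows "(\<Union>\<tau>'\<in>subst_tile lam \<sigma> \<tau>. support T \<tau>') = (\<lambda>z. of_real lam * z) ` support T \<tau>"
proof -
  have *: "(\<Union>\<tau>'\<in>\<sigma> i. support T \<tau>') = (\<lambda>z. of_real lam * z) ` T i" for i
    using assms by (simp add: self_similar_substitution_def)
  have **: "(\<Union>\<tau>'\<in>\<sigma> i. f ` support T \<tau>') = (\<lambda>z. f (of_real lam * z)) ` T i"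
    for i and f :: "complex \<Rightarrow> complex"
    unfolding image_UN [symmetric] * by (simp add: image_image)
  show ?thesis
    by (simp add: subst_tile_def support_move support_mirror ** image_image)
       (simp add: support_def image_image algebra_simps)
qed

text \<open>
  The matrix power is iterated matrix multiplication, because \<open>^\<close> on the vector type
  is the componentwise power.
\<close>

definition substitution_matrix :: "('m::finite \<Rightarrow> 'm tile set) \<Rightarrow> nat ^ 'm ^ 'm" where
  "substitution_matrix \<sigma> = (\<chi> i j. card {\<tau> \<in> \<sigma> i. tile_type \<tau> = j})"

definition primitive_substitution :: "('m::finite \<Rightarrow> 'm tile set) \<Rightarrow> bool" where
  "primitive_substitution \<sigma> \<longleftrightarrow>
     (\<exists>k\<ge>1. \<forall>i j. (((**) (substitution_matrix \<sigma>) ^^ k) (mat 1)) $ i $ j > 0)"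

definition substitution_tiling ::
    "('m \<Rightarrow> complex set) \<Rightarrow> real \<Rightarrow> ('m \<Rightarrow> 'm tile set) \<Rightarrow> 'm tile set \<Rightarrow> bool" where
  "substitution_tiling T lam \<sigma> X \<longleftrightarrow>
     tiling T X \<and>
     (\<forall>P. patch P X \<longrightarrow>
        (\<exists>n\<ge>1. \<exists>i. \<exists>Q. patch Q (subst_iter lam \<sigma> n i) \<and> congruent_tiles P Q))"

text \<open>
  Statistical circular symmetry asks for one enumeration by non-decreasing distance from the
  origin. Since ties may be broken arbitrarily the choice is immaterial; as the property is
  used as a hypothesis, the existential reading is the weakest one. The enumeration is
  indexed from 0.
\<close>

definition statistical_circular_symmetry ::
    "('m \<Rightarrow> complex set) \<Rightarrow> 'm tile set \<Rightarrow> bool" where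
  "statistical_circular_symmetry T X \<longleftrightarrow>
     (\<exists>S :: nat \<Rightarrow> 'm tile.
        bij_betw S UNIV X \<and>
        mono (\<lambda>j. infdist 0 (support T (S j))) \<and>
        (\<forall>x y. 0 \<le> x \<and> x < y \<and> y < 2 * pi \<longrightarrow>
           (\<lambda>n. (1 / real n) * (\<Sum>j<n. indicat_real {x..y} (tile_angle (S j))))
             \<longlonglongrightarrow> (y - x) / (2 * pi)))"

end

theory Submission
  imports Defs
begin

text \<open>
  Every large ball contains a supertile of any prescribed level, hence, by primitivity, a congruent
  copy of any given patch; the point is to control its orientation. Statistical circular symmetry
  enters only through the fact that infinitely many angles occur, so that some two tiles of the same
  type and chirality differ by a rotation through an arbitrarily small angle \<open>\<delta>\<close>. By
  primitivity such a pair already occurs inside a single supertile of a type \<open>i\<close>, both tiles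
  being of type \<open>i\<close> again. Iterating $N$ times yields copies of \<open>i\<close> at the angles
  $N\theta + l\delta$ for $0 \le l \le N$, which for large $N$ are \<open>\<epsilon>\<close>-dense in the circle.
  Finally, either both chiralities of \<open>i\<close> can be reached, or only one occurs in the tiling and
  the copies of the patch are automatically unreflected.
\<close>

section \<open>Isometries of the plane acting on labelled tiles\<close>

definition act :: "bool \<Rightarrow> real \<Rightarrow> complex \<Rightarrow> 'm tile \<Rightarrow> 'm tile" where
  "act c \<beta> s \<tau> = move \<beta> s (if c then mirror \<tau> else \<tau>)"

definition isom :: "bool \<Rightarrow> real \<Rightarrow> complex \<Rightarrow> complex \<Rightarrow> complex" where
  "isom c \<beta> s z = cis \<beta> * (if c then cnj z else z) + s"

lemma rmod_add_left: "(x rmod z + y) rmod z = (x + y) rmod (z::real)"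
  by (metis rmod_add rmod_rmod)

lemma rmod_add_right: "(x + y rmod z) rmod z = (x + y) rmod (z::real)"
  by (metis rmod_add rmod_rmod)

lemma rmod_diff_right: "(x - y rmod z) rmod z = (x - y) rmod (z::real)"
  by (metis rmod_diff rmod_rmod)

lemma act_eq:
  "act c \<beta> s \<tau> = Tile (tile_type \<tau>) (reflected \<tau> \<noteq> c)
     ((\<beta> + (if c then - tile_angle \<tau> else tile_angle \<tau>)) rmod (2 * pi)) (isom c \<beta> s (tile_shift \<tau>))"
  by (simp add: act_def move_def mirror_def isom_def rmod_add_left rmod_add_right add.commute)

text \<open>The composition law of the Euclidean group. An outer reflection conjugates the inner
  rotation into its inverse, hence the sign of \<open>\<beta>'\<close>; chiralities combine by
  exclusive or, written \<open>\<noteq>\<close> on Booleans.\<close>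

lemma act_act:
  "act c \<beta> s (act c' \<beta>' s' \<tau>) = act (c \<noteq> c') (\<beta> + (if c then - \<beta>' else \<beta>')) (isom c \<beta> s s') \<tau>"
proof -
  have "cis (\<beta> - \<beta>') = cis \<beta> * cis (- \<beta>')"
    by (simp add: cis_mult)
  thus ?thesis
    by (cases c; cases c')
       (simp_all add: act_eq isom_def rmod_add_right rmod_diff_right cis_mult[symmetric]
          algebra_simps cis_cnj)
qed

lemma act_rmod: "act c (\<beta> rmod (2 * pi)) s \<tau> = act c \<beta> s \<tau>"
  by (simp add: act_eq isom_def rmod_add_left cis_rmod_2pi add_diff_eq flip: diff_conv_add_uminus)

lemma rmod_copies: "\<tau> \<in> copies \<Longrightarrow> tile_angle \<tau> rmod (2 * pi) = tile_angle \<tau>"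
  by (intro rmod_idem) (auto simp: copies_def)

lemma act_id: "\<tau> \<in> copies \<Longrightarrow> act False 0 0 \<tau> = \<tau>"
  by (simp add: act_eq isom_def rmod_copies)

text \<open>Restricted to \<open>copies\<close>, since \<open>act\<close> normalises angles and so
  is the identity only on tiles whose angle is already normalised.\<close>

lemma act_inverse:
  obtains c' \<beta>' s' where "\<And>\<tau> :: 'm tile. \<tau> \<in> copies \<Longrightarrow> act c' \<beta>' s' (act c \<beta> s \<tau>) = \<tau>"
proof (cases c)
  case True
  \<comment> \<open>Reflecting and then rotating through \<open>\<beta>\<close> is an involution
    apart from the translation, so the inverse keeps \<open>\<beta>\<close>; only the shift must be
    cancelled.\<close>
  have "isom True \<beta> (- isom True \<beta> 0 s) s = 0"
    by (simp add: isom_def)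
  hence "act True \<beta> (- isom True \<beta> 0 s) (act c \<beta> s \<tau>) = \<tau>" if "\<tau> \<in> copies" for \<tau> :: "'m tile"
    using True that by (simp add: act_act act_id)
  thus thesis by (rule that)
next
  case False
  have "isom False (- \<beta>) (- isom False (- \<beta>) 0 s) s = 0"
    by (simp add: isom_def)
  hence "act False (- \<beta>) (- isom False (- \<beta>) 0 s) (act c \<beta> s \<tau>) = \<tau>" if "\<tau> \<in> copies" for \<tau> :: "'m tile"
    using False that by (simp add: act_act act_id)
  thus thesis by (rule that)
qed

lemma act_in_copies: "act c \<beta> s \<tau> \<in> copies"
  by (simp add: act_def move_in_copies)

lemma support_act: "support T (act c \<beta> s \<tau>) = isom c \<beta> s ` support T \<tau>"
  by (simp add: act_def support_move support_mirror image_image isom_def)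

lemma dist_isom: "dist (isom c \<beta> s z) (isom c \<beta> s w) = dist z w"
proof -
  have "isom c \<beta> s z - isom c \<beta> s w = cis \<beta> * (if c then cnj (z - w) else z - w)"
    by (simp add: isom_def algebra_simps)
  thus ?thesis by (simp add: dist_norm norm_mult del: complex_cnj_diff)
qed

lemma surj_isom: "surj (isom c \<beta> s)"
proof (rule surjI)
  fix z show "isom c \<beta> s (if c then cnj (cis (- \<beta>) * (z - s)) else cis (- \<beta>) * (z - s)) = z"
    by (simp add: isom_def mult.assoc[symmetric] cis_mult)
qed

lemma isom_ball: "isom c \<beta> s ` ball z r = ball (isom c \<beta> s z) r"
proof (intro equalityI subsetI)
  fix w assume "w \<in> ball (isom c \<beta> s z) r"
  moreover obtain v where "w = isom c \<beta> s v" using surj_isom by blast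
  ultimately show "w \<in> isom c \<beta> s ` ball z r" by (auto simp: dist_isom)
qed (auto simp: dist_isom)

lemma isom_cball: "isom c \<beta> s ` cball z r = cball (isom c \<beta> s z) r"
proof (intro equalityI subsetI)
  fix w assume "w \<in> cball (isom c \<beta> s z) r"
  moreover obtain v where "w = isom c \<beta> s v" using surj_isom by blast
  ultimately show "w \<in> isom c \<beta> s ` cball z r" by (auto simp: dist_isom)
qed (auto simp: dist_isom)

lemma inj_isom: "inj (isom c \<beta> s)"
  by (metis dist_isom dist_eq_0_iff injI)

lemma interior_isom: "interior (isom c \<beta> s ` A) = isom c \<beta> s ` interior A"
proof
  show "interior (isom c \<beta> s ` A) \<subseteq> isom c \<beta> s ` interior A"
  proof
    fix w assume w: "w \<in> interior (isom c \<beta> s ` A)"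
    then obtain e where e: "e > 0" "ball w e \<subseteq> isom c \<beta> s ` A"
      by (auto simp: mem_interior)
    obtain z where z: "w = isom c \<beta> s z" using surj_isom by blast
    have "ball z e \<subseteq> A" using e(2) inj_isom[of c \<beta> s]
      by (metis z isom_ball inj_image_subset_iff)
    hence "z \<in> interior A" using e(1) by (auto simp: mem_interior)
    thus "w \<in> isom c \<beta> s ` interior A" using z by blast
  qed
  show "isom c \<beta> s ` interior A \<subseteq> interior (isom c \<beta> s ` A)"
    by (auto simp: mem_interior) (metis image_mono isom_ball)
qed

text \<open>Reduces statements about a tile to its unrotated prototile, the starting point of
  \<open>subst_iter\<close>.\<close>

lemma act_prototile:
  "\<tau> \<in> copies \<Longrightarrow>
     \<tau> = act (reflected \<tau>) (tile_angle \<tau>) (tile_shift \<tau>) (Tile (tile_type \<tau>) False 0 0)"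
  by (cases \<tau>) (simp add: act_eq isom_def rmod_copies[of "Tile _ _ _ _", simplified])

lemma congruent_tiles_act: "congruent_tiles P Q \<longleftrightarrow> (\<exists>c \<beta> s. Q = act c \<beta> s ` P)"
proof
  assume "\<exists>c \<beta> s. Q = act c \<beta> s ` P"
  then obtain c \<beta> s where "Q = act c \<beta> s ` P" by blast
  thus "congruent_tiles P Q"
    unfolding congruent_tiles_def image_image act_def by (cases c) auto
next
  assume "congruent_tiles P Q"
  then obtain \<beta> s where "Q = act False \<beta> s ` P \<or> Q = act True \<beta> s ` P"
    unfolding congruent_tiles_def image_image act_def by auto
  thus "\<exists>c \<beta> s. Q = act c \<beta> s ` P" by blast
qed

lemma packing_act:
  assumes "packing T Y" shows "packing T (act c \<beta> s ` Y)"
  using assms inj_isom[of c \<beta> s]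
  by (fastforce simp: packing_def support_act interior_isom dest: injD)

text \<open>A finite form of the Baire property. If the first closed set does not contain
  \<open>U\<close>, removing it from \<open>U\<close> leaves a nonempty open set covered by the
  others, so the induction must let \<open>U\<close> vary.\<close>

lemma finite_closed_cover_interior:
  assumes "finite F" "\<And>A. A \<in> F \<Longrightarrow> closed A" "open U" "U \<noteq> {}" "U \<subseteq> \<Union>F"
  shows "\<exists>A\<in>F. interior A \<inter> U \<noteq> {}"
  using assms
proof (induction F arbitrary: U rule: finite_induct)
  case (insert A F)
  show ?case
  proof (cases "U - A = {}")
    case True
    hence "U \<subseteq> interior A" using insert.prems by (intro interior_maximal) auto
    thus ?thesis using insert.prems by auto
  next
    case False
    have "\<exists>B\<in>F. interior B \<inter> (U - A) \<noteq> {}"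
      by (rule insert.IH) (use insert.prems False in auto)
    thus ?thesis by blast
  qed
qed simp

section \<open>Substitution commutes with isometries\<close>

locale substitution =
  fixes T :: "'m::finite \<Rightarrow> complex set" and lam :: real and \<sigma> :: "'m \<Rightarrow> 'm tile set"
  assumes prototiles: "prototiles T"
    and self_similar: "self_similar_substitution T lam \<sigma>"
begin

abbreviation subst_pow :: "nat \<Rightarrow> 'm tile set \<Rightarrow> 'm tile set" where
  "subst_pow n \<equiv> subst_set lam \<sigma> ^^ n"

lemma lam_gt_1: "lam > 1" and \<sigma>_copies: "\<sigma> i \<subseteq> copies"
  and packing_\<sigma>: "packing T (\<sigma> i)"
  using self_similar by (auto simp: self_similar_substitution_def)

lemma subst_tile_eq:
  "subst_tile lam \<sigma> \<tau> = act (reflected \<tau>) (tile_angle \<tau>) (of_real lam * tile_shift \<tau>) ` \<sigma> (tile_type \<tau>)"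
  by (simp add: subst_tile_def act_def image_image)

text \<open>Scaling by \<open>lam\<close> commutes with the linear part of an isometry, so only the
  shift is scaled.\<close>

lemma subst_tile_act:
  "subst_tile lam \<sigma> (act c \<beta> s \<tau>) = act c \<beta> (of_real lam * s) ` subst_tile lam \<sigma> \<tau>"
proof -
  have *: "isom c \<beta> (of_real lam * s) (of_real lam * z) = of_real lam * isom c \<beta> s z" for z
    by (simp add: isom_def algebra_simps)
  have **: "(reflected \<tau> \<noteq> c) = (c \<noteq> reflected \<tau>)" by auto
  show ?thesis
    unfolding subst_tile_eq image_image act_act * by (simp add: act_eq[of c \<beta> s \<tau>] act_rmod **)
qed

lemma subst_set_act:
  "subst_set lam \<sigma> (act c \<beta> s ` Y) = act c \<beta> (of_real lam * s) ` subst_set lam \<sigma> Y"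
  by (simp add: subst_set_def subst_tile_act image_UN)

lemma subst_pow_act:
  "subst_pow n (act c \<beta> s ` Y) = act c \<beta> (of_real lam ^ n * s) ` subst_pow n Y"
  by (induction n) (simp_all add: subst_set_act mult.assoc)

lemma subst_pow_UN: "subst_pow n Y = (\<Union>\<tau>\<in>Y. subst_pow n {\<tau>})"
proof (induction n)
  case (Suc n)
  have "subst_set lam \<sigma> (\<Union>\<tau>\<in>Y. Z \<tau>) = (\<Union>\<tau>\<in>Y. subst_set lam \<sigma> (Z \<tau>))" for Z :: "'m tile \<Rightarrow> 'm tile set"
    by (auto simp: subst_set_def)
  thus ?case using Suc by simp
qed simp

lemma subst_pow_tile:
  assumes "\<tau> \<in> copies"
  shows "subst_pow n {\<tau>} =
    act (reflected \<tau>) (tile_angle \<tau>) (of_real lam ^ n * tile_shift \<tau>) ` subst_iter lam \<sigma> n (tile_type \<tau>)"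
proof -
  have "subst_pow n {\<tau>} =
    subst_pow n (act (reflected \<tau>) (tile_angle \<tau>) (tile_shift \<tau>) ` {Tile (tile_type \<tau>) False 0 0})"
    using act_prototile[OF assms] by simp
  thus ?thesis unfolding subst_pow_act subst_iter_def .
qed

lemma subst_set_copies: "subst_set lam \<sigma> Y \<subseteq> copies"
  by (auto simp: subst_set_def subst_tile_eq act_in_copies)

lemma subst_iter_copies: "subst_iter lam \<sigma> n i \<subseteq> copies"
  using subst_set_copies by (cases n) (auto simp: subst_iter_def copies_def)

lemma subst_iter_add: "subst_iter lam \<sigma> (n + m) i = (\<Union>\<tau>\<in>subst_iter lam \<sigma> n i. subst_pow m {\<tau>})"
  unfolding subst_iter_def by (subst add.commute) (simp add: funpow_add subst_pow_UN[symmetric])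

section \<open>Orientations of tiles inside supertiles\<close>

text \<open>
  Angles are recorded as arbitrary reals modulo $2\pi$, so that orientations compose by addition.
\<close>

definition orientations :: "nat \<Rightarrow> 'm \<Rightarrow> 'm \<Rightarrow> (bool \<times> real) set" where
  "orientations n i j = {(c, \<beta>). \<exists>t. Tile j c (\<beta> rmod (2 * pi)) t \<in> subst_iter lam \<sigma> n i}"

lemma orientationsI:
  assumes "\<tau> \<in> subst_iter lam \<sigma> n i" "\<beta> rmod (2 * pi) = tile_angle \<tau>"
  shows "(reflected \<tau>, \<beta>) \<in> orientations n i (tile_type \<tau>)"
  using assms unfolding orientations_def by (cases \<tau>) auto

lemma orientations_shift:
  assumes "(c, \<beta>) \<in> orientations n i j"
  shows "(c, \<beta> + of_int k * (2 * pi)) \<in> orientations n i j"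
proof -
  have "(\<beta> + of_int k * (2 * pi)) rmod (2 * pi) = \<beta> rmod (2 * pi)"
    using rcong_altdef[of \<beta> "\<beta> + of_int k * (2 * pi)" "2 * pi"] by (auto simp: rcong_def)
  thus ?thesis using assms by (simp add: orientations_def)
qed

text \<open>Applying \<open>m\<close> further substitutions turns a tile of type \<open>j\<close> at
  level \<open>n\<close> into a congruent copy of the whole level-\<open>m\<close> supertile of
  \<open>j\<close>.\<close>

lemma subst_iter_contains:
  assumes "(c, \<beta>) \<in> orientations n i j"
  obtains s where "act c \<beta> s ` subst_iter lam \<sigma> m j \<subseteq> subst_iter lam \<sigma> (n + m) i"
proof -
  obtain t where t: "Tile j c (\<beta> rmod (2 * pi)) t \<in> subst_iter lam \<sigma> n i"
    using assms by (auto simp: orientations_def)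
  hence "subst_pow m {Tile j c (\<beta> rmod (2 * pi)) t} \<subseteq> subst_iter lam \<sigma> (n + m) i"
    by (auto simp: subst_iter_add)
  moreover have "Tile j c (\<beta> rmod (2 * pi)) t \<in> copies" using t subst_iter_copies by blast
  ultimately have "act c \<beta> (of_real lam ^ m * t) ` subst_iter lam \<sigma> m j \<subseteq> subst_iter lam \<sigma> (n + m) i"
    by (simp add: subst_pow_tile act_rmod)
  thus thesis by (rule that)
qed

text \<open>Nested supertiles compose their isometries, so this is the composition law of
  \<open>act_act\<close> with the translations forgotten.\<close>

lemma orientations_add:
  assumes "(c, \<beta>) \<in> orientations n i j" "(c', \<beta>') \<in> orientations m j l"
  shows "(c \<noteq> c', \<beta> + (if c then - \<beta>' else \<beta>')) \<in> orientations (n + m) i l"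
proof -
  obtain s where s: "act c \<beta> s ` subst_iter lam \<sigma> m j \<subseteq> subst_iter lam \<sigma> (n + m) i"
    using subst_iter_contains[OF assms(1)] .
  obtain t where "Tile l c' (\<beta>' rmod (2 * pi)) t \<in> subst_iter lam \<sigma> m j"
    using assms(2) by (auto simp: orientations_def)
  with s have "act c \<beta> s (Tile l c' (\<beta>' rmod (2 * pi)) t) \<in> subst_iter lam \<sigma> (n + m) i" by blast
  from orientationsI[OF this, of "\<beta> + (if c then - \<beta>' else \<beta>')"]
  have "(c' \<noteq> c, \<beta> + (if c then - \<beta>' else \<beta>')) \<in> orientations (n + m) i l"
    by (cases c) (auto simp: act_eq rmod_add_right rmod_diff_right)
  moreover have "(c' \<noteq> c) = (c \<noteq> c')" by auto
  ultimately show ?thesis by simp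
qed

lemma orientations_0: "(False, 0) \<in> orientations 0 i i"
  by (auto simp: orientations_def subst_iter_def)

text \<open>Descend \<open>N\<close> times from type \<open>i\<close> to type \<open>i\<close>,
  turning by \<theta> or by \<open>\<theta> + \<delta>\<close> each time; \<open>l\<close> counts
  the choices of the second kind.\<close>

lemma orientations_pow:
  assumes "(False, \<theta>) \<in> orientations n i i" "(False, \<theta> + \<delta>) \<in> orientations n i i" "l \<le> N"
  shows "(False, real N * \<theta> + real l * \<delta>) \<in> orientations (N * n) i i"
  using assms(3)
proof (induction N arbitrary: l)
  case 0 thus ?case using orientations_0 by simp
next
  case (Suc N)
  show ?case
  proof (cases "l \<le> N")
    case True
    from orientations_add[OF assms(1) Suc.IH[OF this]] show ?thesis
      by (simp add: algebra_simps)
  next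
    case False
    hence "l = Suc N" using Suc.prems by simp
    with orientations_add[OF assms(2) Suc.IH[OF order_refl]] show ?thesis
      by (simp add: algebra_simps)
  qed
qed

text \<open>With \<open>N * \<delta> \<ge> 2 * pi\<close> the angles from
  \<open>orientations_pow\<close> run once around the circle in steps of \<delta>. The level depends
  on \<delta> but not on the target \<phi>.\<close>

lemma orientations_dense:
  assumes "(False, \<theta>) \<in> orientations n i i" "(False, \<theta> + \<delta>) \<in> orientations n i i" "0 < \<delta>" "\<delta> < \<epsilon>"
  obtains M where "\<And>\<phi>. \<exists>\<beta>. (False, \<beta>) \<in> orientations M i i \<and> \<bar>\<beta> - \<phi>\<bar> < \<epsilon>"
proof -
  define N where "N = nat \<lceil>2 * pi / \<delta>\<rceil>"
  have N: "real N \<ge> 2 * pi / \<delta>" unfolding N_def by linarith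
  show thesis
  proof (rule that[of "N * n"])
    fix \<phi> :: real
    \<comment> \<open>Full turns reduce the target, measured from \<open>N * \<theta>\<close>, to a
      remainder \<open>r\<close> in one period; \<open>l\<close> then counts the steps \<delta> that
      fit below \<open>r\<close>.\<close>
    define k where "k = \<lfloor>(\<phi> - N * \<theta>) / (2 * pi)\<rfloor>"
    define r where "r = \<phi> - N * \<theta> - of_int k * (2 * pi)"
    have k: "of_int k * (2 * pi) \<le> \<phi> - N * \<theta>" "\<phi> - N * \<theta> < (of_int k + 1) * (2 * pi)"
      using floor_divide_lower[of "2 * pi" "\<phi> - N * \<theta>"] floor_divide_upper[of "2 * pi" "\<phi> - N * \<theta>"]
      by (auto simp: k_def)
    hence r: "0 \<le> r" "r < 2 * pi" by (auto simp: r_def algebra_simps)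
    define l where "l = nat \<lfloor>r / \<delta>\<rfloor>"
    have l0: "real l = of_int \<lfloor>r / \<delta>\<rfloor>" using r assms by (simp add: l_def)
    have l: "real l * \<delta> \<le> r" "r < (real l + 1) * \<delta>"
      unfolding l0 using floor_divide_lower[of \<delta> r] floor_divide_upper[of \<delta> r] assms by auto
    have "real l \<le> r / \<delta>" using l assms by (simp add: field_simps)
    also have "\<dots> \<le> 2 * pi / \<delta>" using r assms by (intro divide_right_mono) auto
    also have "\<dots> \<le> real N" by (rule N)
    finally have "l \<le> N" by simp
    from orientations_shift[OF orientations_pow[OF assms(1,2) this], of k]
    have "(False, real N * \<theta> + real l * \<delta> + of_int k * (2 * pi)) \<in> orientations (N * n) i i" .
    moreover have "\<bar>real N * \<theta> + real l * \<delta> + of_int k * (2 * pi) - \<phi>\<bar> < \<epsilon>"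
      using l assms by (auto simp: r_def algebra_simps)
    ultimately show "\<exists>\<beta>. (False, \<beta>) \<in> orientations (N * n) i i \<and> \<bar>\<beta> - \<phi>\<bar> < \<epsilon>" by blast
  qed
qed

text \<open>A positive entry of the \<open>k\<close>-th matrix power comes from a path of
  \<open>k\<close> types from \<open>i\<close> to \<open>j\<close>, each contained in the
  substitution of its predecessor. The chirality and angle accumulated along the path are not
  controlled.\<close>

lemma orientations_primitive:
  assumes "(((**) (substitution_matrix \<sigma>) ^^ k) (mat 1)) $ i $ j > 0"
  shows "\<exists>c \<beta>. (c, \<beta>) \<in> orientations k i j"
  using assms
proof (induction k arbitrary: i)
  case 0
  hence "i = j" by (auto simp: mat_def split: if_splits)
  thus ?case using orientations_0 by blast
next
  case (Suc k)
  define B where "B = ((**) (substitution_matrix \<sigma>) ^^ k) (mat 1)"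
  have "(substitution_matrix \<sigma> ** B) $ i $ j \<noteq> 0" using Suc.prems by (simp add: B_def)
  hence "(\<Sum>l\<in>UNIV. substitution_matrix \<sigma> $ i $ l * B $ l $ j) \<noteq> 0"
    by (simp only: matrix_matrix_mult_def vec_lambda_beta not_False_eq_True)
  then obtain l where "substitution_matrix \<sigma> $ i $ l * B $ l $ j \<noteq> 0"
    by (rule sum.not_neutral_contains_not_neutral)
  hence l: "substitution_matrix \<sigma> $ i $ l > 0" "B $ l $ j > 0"
    by auto
  from l(1) have "{\<tau> \<in> \<sigma> i. tile_type \<tau> = l} \<noteq> {}"
    unfolding substitution_matrix_def by (auto simp: card_gt_0_iff)
  then obtain \<tau> where \<tau>: "\<tau> \<in> \<sigma> i" "tile_type \<tau> = l" by blast
  hence "\<tau> \<in> subst_iter lam \<sigma> 1 i" by (simp only: subst_iter_1[OF self_similar])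
  from orientationsI[OF this, of "tile_angle \<tau>"] \<tau> \<sigma>_copies
  have "(reflected \<tau>, tile_angle \<tau>) \<in> orientations 1 i l" by (auto simp: rmod_copies subset_iff)
  with Suc.IH[OF l(2)[unfolded B_def]] show ?case using orientations_add[of _ _ 1 i l _ _ k j] by fastforce
qed

section \<open>Size, packing and local finiteness of tiles\<close>

lemma compact_support: "compact (support T \<tau>)"
proof -
  have "compact (T (tile_type \<tau>))" using prototiles by (simp add: prototiles_def)
  thus ?thesis unfolding support_def
    by (auto intro!: compact_continuous_image continuous_intros)
qed

lemma support_eq:
  "support T \<tau> = isom (reflected \<tau>) (tile_angle \<tau>) (tile_shift \<tau>) ` T (tile_type \<tau>)"
  by (simp add: support_def isom_def image_image)

definition radius :: real where
  "radius = (SOME D. D > 0 \<and> (\<forall>i. T i \<subseteq> cball 0 D))"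

text \<open>Finitely many compact prototiles have a common bound, which justifies the choice in
  \<open>radius\<close>.\<close>

lemma radius_pos: "radius > 0" and prototile_radius: "T i \<subseteq> cball 0 radius"
proof -
  have "bounded (\<Union>i\<in>UNIV. T i)"
    using prototiles by (intro bounded_UN) (auto simp: prototiles_def compact_imp_bounded)
  then obtain D where "D > 0" "(\<Union>i. T i) \<subseteq> cball 0 D"
    using bounded_subset_ballD[of _ 0] ball_subset_cball by (metis order_trans)
  hence "\<exists>D. D > 0 \<and> (\<forall>i. T i \<subseteq> cball 0 D)" by blast
  hence "radius > 0 \<and> (\<forall>i. T i \<subseteq> cball 0 radius)"
    unfolding radius_def by (rule someI_ex)
  thus "radius > 0" "T i \<subseteq> cball 0 radius" by auto
qed

lemma support_diameter:
  assumes "z \<in> support T \<tau>" "w \<in> support T \<tau>" shows "dist z w \<le> 2 * radius"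
proof -
  obtain z' w' where *: "z' \<in> T (tile_type \<tau>)" "w' \<in> T (tile_type \<tau>)" "dist z w = dist z' w'"
    using assms by (auto simp: support_eq dist_isom)
  have "norm z' \<le> radius" "norm w' \<le> radius"
    using * prototile_radius by (force simp: subset_iff)+
  thus ?thesis using * norm_triangle_ineq4[of z' w'] by (simp add: dist_norm)
qed

lemma uniform_inradius:
  obtains r where "r > 0" "\<forall>\<tau>. \<exists>z. ball z r \<subseteq> support T \<tau>"
proof -
  have "\<exists>z e. e > 0 \<and> ball z e \<subseteq> T i" for i
    using prototiles unfolding prototiles_def mem_interior[symmetric]
    by (metis all_not_in_conv mem_interior)
  then obtain z e where ze: "\<And>i. e i > 0" "\<And>i. ball (z i) (e i) \<subseteq> T i" by metis
  define r where "r = Min (range e)"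
  have r: "r \<le> e i" for i by (simp add: r_def)
  have "ball (isom (reflected \<tau>) (tile_angle \<tau>) (tile_shift \<tau>) (z (tile_type \<tau>))) r \<subseteq> support T \<tau>" for \<tau>
    unfolding support_eq isom_ball[symmetric]
    by (intro image_mono) (use ze(2) r in \<open>meson subset_ball order_trans\<close>)
  moreover have "r > 0" using ze(1) by (auto simp: r_def)
  ultimately show thesis using that by blast
qed

lemma interior_support: "interior (support T \<tau>) \<noteq> {}"
  using prototiles unfolding prototiles_def support_eq interior_isom by simp

lemma support_subst_pow:
  "(\<Union>\<tau>\<in>subst_pow n Y. support T \<tau>) = (\<lambda>z. of_real lam ^ n * z) ` (\<Union>\<tau>\<in>Y. support T \<tau>)"
proof (induction n)
  case (Suc n)
  have "(\<Union>\<tau>\<in>subst_pow (Suc n) Y. support T \<tau>) = (\<Union>\<tau>\<in>subst_pow n Y. \<Union>\<tau>'\<in>subst_tile lam \<sigma> \<tau>. support T \<tau>')"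
    by (simp add: subst_set_def)
  also have "\<dots> = (\<lambda>z. of_real lam * z) ` (\<Union>\<tau>\<in>subst_pow n Y. support T \<tau>)"
    unfolding support_subst_tile[OF self_similar] by blast
  finally show ?case unfolding Suc by (simp add: image_image mult.assoc)
qed simp

text \<open>Tiles with the same parent belong to a moved copy of the packing
  \<open>\<sigma> i\<close>. Tiles with different parents lie in the scaled parents, whose interiors
  are disjoint because scaling is linear and injective.\<close>

lemma packing_subst_set:
  assumes "packing T Y"
  shows "packing T (subst_set lam \<sigma> Y)"
  unfolding packing_def
proof (intro ballI impI)
  fix a b assume "a \<in> subst_set lam \<sigma> Y" "b \<in> subst_set lam \<sigma> Y" "a \<noteq> b"
  then obtain \<tau> \<tau>' where *: "\<tau> \<in> Y" "\<tau>' \<in> Y" "a \<in> subst_tile lam \<sigma> \<tau>" "b \<in> subst_tile lam \<sigma> \<tau>'"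
    by (auto simp: subst_set_def)
  show "interior (support T a) \<inter> interior (support T b) = {}"
  proof (cases "\<tau> = \<tau>'")
    case True
    have "packing T (subst_tile lam \<sigma> \<tau>)"
      unfolding subst_tile_eq by (intro packing_act packing_\<sigma>)
    thus ?thesis using * True \<open>a \<noteq> b\<close> unfolding packing_def by blast
  next
    case False
    define f :: "complex \<Rightarrow> complex" where "f = (\<lambda>z. of_real lam * z)"
    have f: "linear f" "inj f"
      using lam_gt_1 by (auto simp: f_def inj_on_def intro: bounded_linear.linear bounded_linear_mult_right)
    have "support T a \<subseteq> f ` support T \<tau>" "support T b \<subseteq> f ` support T \<tau>'"
      using * support_subst_tile[OF self_similar] unfolding f_def by blast+
    hence "interior (support T a) \<subseteq> f ` interior (support T \<tau>)"
          "interior (support T b) \<subseteq> f ` interior (support T \<tau>')"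
      by (metis interior_injective_linear_image[OF f] interior_mono)+
    moreover have "interior (support T \<tau>) \<inter> interior (support T \<tau>') = {}"
      using assms * False unfolding packing_def by blast
    ultimately show ?thesis using f(2) by (blast dest: injD)
  qed
qed

lemma packing_subst_iter: "packing T (subst_iter lam \<sigma> n i)"
  unfolding subst_iter_def
  by (induction n) (simp add: packing_def, simp add: packing_subst_set)

text \<open>Every tile contains a ball of one fixed radius \<open>r\<close>. Assign to each tile the
  point of a finite \<open>r / 2\<close>-net nearest enough to its ball centre. Tiles sharing a net
  point have centres closer than \<open>r\<close>, so their interiors meet and they
  coincide.\<close>

lemma locally_finite:
  assumes "packing T X"
  shows "finite {\<tau> \<in> X. support T \<tau> \<inter> cball x R \<noteq> {}}" (is "finite ?F")
proof -
  obtain r where r: "r > 0" "\<forall>\<tau>. \<exists>z. ball z r \<subseteq> support T \<tau>" by (rule uniform_inradius)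
  obtain z where z: "\<And>\<tau>. ball (z \<tau>) r \<subseteq> support T \<tau>" using r(2) by metis
  have "compact (cball x (R + 2 * radius))" by simp
  then obtain K where K: "finite K" "cball x (R + 2 * radius) \<subseteq> (\<Union>y\<in>K. ball y (r / 2))"
    unfolding compact_eq_totally_bounded using r(1) half_gt_zero by blast
  have near: "\<exists>y. y \<in> K \<and> dist y (z \<tau>) < r / 2" if \<tau>: "\<tau> \<in> ?F" for \<tau>
  proof -
    obtain w where w: "w \<in> support T \<tau>" "dist x w \<le> R" using \<tau> by auto
    have "z \<tau> \<in> support T \<tau>" using z[of \<tau>] r(1) by (auto simp: subset_iff)
    with w support_diameter[of w \<tau> "z \<tau>"] dist_triangle[of x "z \<tau>" w]
    have "z \<tau> \<in> cball x (R + 2 * radius)" by simp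
    hence "z \<tau> \<in> (\<Union>y\<in>K. ball y (r / 2))" using K(2) by blast
    thus ?thesis by auto
  qed
  define y where "y \<tau> = (SOME y. y \<in> K \<and> dist y (z \<tau>) < r / 2)" for \<tau>
  have y: "y \<tau> \<in> K \<and> dist (y \<tau>) (z \<tau>) < r / 2" if "\<tau> \<in> ?F" for \<tau>
    unfolding y_def by (rule someI_ex[OF near[OF that]])
  have "inj_on y ?F"
  proof (rule inj_onI)
    fix \<tau> \<tau>' assume *: "\<tau> \<in> ?F" "\<tau>' \<in> ?F" "y \<tau> = y \<tau>'"
    have "dist (z \<tau>) (z \<tau>') < r"
      using y[OF *(1)] y[OF *(2)] *(3) dist_triangle3[of "z \<tau>" "z \<tau>'" "y \<tau>"] by simp
    hence "z \<tau> \<in> ball (z \<tau>) r \<inter> ball (z \<tau>') r" using r(1) by (simp add: dist_commute)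
    hence "z \<tau> \<in> interior (support T \<tau>) \<inter> interior (support T \<tau>')"
      using interior_maximal[OF z open_ball] by blast
    thus "\<tau> = \<tau>'" using assms * unfolding packing_def by blast
  qed
  moreover have "y ` ?F \<subseteq> K" using y by blast
  ultimately show ?thesis using K(1) by (rule inj_on_finite)
qed

section \<open>Supertiles in every large ball\<close>

text \<open>The tiles meeting a ball around \<open>x\<close> form a patch, hence recur in some
  level-\<open>N\<close> supertile. A large ball forces \<open>N > n\<close>, so that supertile
  splits into level-\<open>n\<close> supertiles; the one around the image of \<open>x\<close> stays
  within the ball and is carried back into \<open>X\<close>.\<close>

lemma supertile_in_ball:
  assumes "substitution_tiling T lam \<sigma> X"
  shows "\<exists>R>0. \<forall>x. \<exists>j c \<beta> s. act c \<beta> s ` subst_iter lam \<sigma> n j \<subseteq> X \<and>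
       (\<forall>\<tau> \<in> act c \<beta> s ` subst_iter lam \<sigma> n j. support T \<tau> \<subseteq> cball x R)"
proof -
  \<comment> \<open>The radius must exceed \<open>lam ^ n * radius\<close>, to force
    \<open>N > n\<close>, and be at least \<open>2 * lam ^ n * radius\<close>, a bound for the
    diameter of a level-\<open>n\<close> supertile.\<close>
  define r where "r = 3 * lam ^ n * radius"
  have pow_pos: "lam ^ n > 0" using lam_gt_1 by simp
  have r_pos: "r > 0" unfolding r_def using radius_pos pow_pos by simp
  have X: "X \<subseteq> copies" "(\<Union>\<tau>\<in>X. support T \<tau>) = UNIV" "packing T X"
    using assms by (auto simp: substitution_tiling_def tiling_def)
  \<comment> \<open>Tiles meeting the ball of radius \<open>r\<close> may stick out by one tile
    diameter, at most \<open>2 * radius\<close>.\<close>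
  show ?thesis
  proof (intro exI[of _ "r + 2 * radius"] conjI allI)
    fix x
    define F where "F = {\<tau> \<in> X. support T \<tau> \<inter> cball x r \<noteq> {}}"
    have "finite F" unfolding F_def by (rule locally_finite[OF X(3)])
    hence "patch F X" by (auto simp: patch_def F_def)
    then obtain N i Q where "patch Q (subst_iter lam \<sigma> N i)" "congruent_tiles F Q"
      using assms unfolding substitution_tiling_def by metis
    then obtain c \<beta> s where Q: "finite Q" "Q \<subseteq> subst_iter lam \<sigma> N i" "Q = act c \<beta> s ` F"
      by (auto simp: patch_def congruent_tiles_act)
    define x' where "x' = isom c \<beta> s x"
    have "cball x r \<subseteq> (\<Union>\<tau>\<in>F. support T \<tau>)" using X(2) unfolding F_def by blast
    hence "isom c \<beta> s ` cball x r \<subseteq> isom c \<beta> s ` (\<Union>\<tau>\<in>F. support T \<tau>)" by (rule image_mono)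
    hence cover: "cball x' r \<subseteq> (\<Union>\<tau>\<in>Q. support T \<tau>)"
      unfolding isom_cball x'_def Q(3) by (simp add: support_act image_UN)
    hence "cball x' r \<subseteq> (\<Union>\<tau>\<in>subst_iter lam \<sigma> N i. support T \<tau>)" using Q(2) by blast
    also have "\<dots> = (\<lambda>z. of_real lam ^ N * z) ` T i"
      unfolding subst_iter_def support_subst_pow by (simp add: support_def)
    finally have cover': "cball x' r \<subseteq> (\<lambda>z. of_real lam ^ N * z) ` T i" .
    also have "\<dots> \<subseteq> cball 0 (lam ^ N * radius)"
    proof (rule image_subsetI)
      fix z assume "z \<in> T i"
      hence "norm z \<le> radius" using prototile_radius[of i] by auto
      thus "of_real lam ^ N * z \<in> cball 0 (lam ^ N * radius)"
        using lam_gt_1 by (simp add: norm_mult norm_power)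
    qed
    finally have "dist x' 0 + r \<le> lam ^ N * radius"
      using r_pos by (simp only: cball_subset_cball_iff) linarith
    hence r_le: "r \<le> lam ^ N * radius" using zero_le_dist[of x' 0] by linarith
    have "lam ^ n < lam ^ N"
    proof (rule ccontr)
      assume "\<not> lam ^ n < lam ^ N"
      hence "lam ^ N * radius \<le> lam ^ n * radius" using radius_pos by (intro mult_right_mono) auto
      with r_le have "r \<le> lam ^ n * radius" by linarith
      moreover have "lam ^ n * radius > 0" using pow_pos radius_pos by simp
      ultimately show False unfolding r_def by linarith
    qed
    hence "n \<le> N" using lam_gt_1 by (simp add: power_strict_increasing_iff less_imp_le)
    have split: "subst_iter lam \<sigma> N i = subst_pow n (subst_iter lam \<sigma> (N - n) i)"
      using \<open>n \<le> N\<close> funpow_add[of n "N - n" "subst_set lam \<sigma>"] by (simp add: subst_iter_def)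
    have "x' \<in> (\<Union>\<tau>\<in>subst_iter lam \<sigma> N i. support T \<tau>)"
    proof -
      have "x' \<in> cball x' r" using r_pos by simp
      thus ?thesis using cover Q(2) by blast
    qed
    then obtain \<tau> where \<tau>: "\<tau> \<in> subst_iter lam \<sigma> (N - n) i"
        "x' \<in> (\<lambda>z. of_real lam ^ n * z) ` support T \<tau>"
      unfolding split support_subst_pow by auto
    \<comment> \<open>Each tile \<rho> of the small supertile is covered by \<open>Q\<close>, so its
      interior meets that of some tile of \<open>Q\<close>. Both belong to the packing
      \<open>subst_iter lam \<sigma> N i\<close> and therefore coincide.\<close>
    have "subst_pow n {\<tau>} \<subseteq> Q"
    proof
      fix \<rho> assume \<rho>: "\<rho> \<in> subst_pow n {\<tau>}"
      have "support T \<rho> \<subseteq> (\<lambda>z. of_real lam ^ n * z) ` support T \<tau>"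
        using \<rho> support_subst_pow[of n "{\<tau>}"] by auto
      also have "\<dots> \<subseteq> cball x' r"
      proof (rule image_subsetI)
        fix z assume z: "z \<in> support T \<tau>"
        obtain w where w: "w \<in> support T \<tau>" "x' = of_real lam ^ n * w" using \<tau>(2) by auto
        have "dist x' (of_real lam ^ n * z) = lam ^ n * dist w z"
          using lam_gt_1 unfolding w(2) dist_norm right_diff_distrib[symmetric]
          by (simp add: norm_mult norm_power)
        also have "\<dots> \<le> lam ^ n * (2 * radius)"
          using support_diameter[OF w(1) z] pow_pos by (intro mult_left_mono) auto
        also have "\<dots> \<le> r" unfolding r_def using radius_pos pow_pos by simp
        finally show "of_real lam ^ n * z \<in> cball x' r" by simp
      qed
      finally have "support T \<rho> \<subseteq> (\<Union>\<tau>\<in>Q. support T \<tau>)" using cover by blast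
      hence "interior (support T \<rho>) \<subseteq> \<Union>(support T ` Q)" using interior_subset by blast
      hence "\<exists>A\<in>support T ` Q. interior A \<inter> interior (support T \<rho>) \<noteq> {}"
        using Q(1) interior_support compact_support
        by (intro finite_closed_cover_interior) (auto simp: compact_imp_closed)
      then obtain q where q: "q \<in> Q" "interior (support T q) \<inter> interior (support T \<rho>) \<noteq> {}"
        by blast
      moreover have "\<rho> \<in> subst_iter lam \<sigma> N i"
        unfolding split using \<rho> \<tau>(1) subst_pow_UN[of n "subst_iter lam \<sigma> (N - n) i"] by blast
      ultimately have "q = \<rho>" using packing_subst_iter[of N i] Q(2) unfolding packing_def by blast
      thus "\<rho> \<in> Q" using q(1) by simp
    qed
    moreover have "\<tau> \<in> copies" using \<tau>(1) subst_iter_copies by blast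
    ultimately obtain j c1 \<beta>1 s1 where j: "act c1 \<beta>1 s1 ` subst_iter lam \<sigma> n j \<subseteq> Q"
      using subst_pow_tile[of \<tau> n] by metis
    obtain c' \<beta>' s' where inv: "\<And>\<tau> :: 'm tile. \<tau> \<in> copies \<Longrightarrow> act c' \<beta>' s' (act c \<beta> s \<tau>) = \<tau>"
      using act_inverse[of c \<beta> s] by blast
    have "act c' \<beta>' s' ` Q = F"
      unfolding Q(3) using inv X(1) by (force simp: F_def image_image)
    hence "act c' \<beta>' s' ` act c1 \<beta>1 s1 ` subst_iter lam \<sigma> n j \<subseteq> F" using j by blast
    then obtain c2 \<beta>2 s2 where sub: "act c2 \<beta>2 s2 ` subst_iter lam \<sigma> n j \<subseteq> F"
      unfolding image_image act_act by blast
    have F_ball: "support T \<tau> \<subseteq> cball x (r + 2 * radius)" if "\<tau> \<in> F" for \<tau>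
    proof
      fix z assume z: "z \<in> support T \<tau>"
      obtain w where w: "w \<in> support T \<tau>" "dist x w \<le> r" using \<open>\<tau> \<in> F\<close> by (auto simp: F_def)
      show "z \<in> cball x (r + 2 * radius)"
        using w(2) support_diameter[OF w(1) z] dist_triangle[of x z w] by simp
    qed
    have "F \<subseteq> X" by (auto simp: F_def)
    with sub F_ball show "\<exists>j c \<beta> s. act c \<beta> s ` subst_iter lam \<sigma> n j \<subseteq> X \<and>
       (\<forall>\<tau> \<in> act c \<beta> s ` subst_iter lam \<sigma> n j. support T \<tau> \<subseteq> cball x (r + 2 * radius))"
      by (meson order_trans subset_iff)
  qed (use r_pos radius_pos in simp)
qed

section \<open>Dense rotations from circular symmetry\<close>

lemma close_orientations:
  assumes "substitution_tiling T lam \<sigma> X" "statistical_circular_symmetry T X" "\<epsilon> > 0"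
  obtains n j l c \<beta> \<delta> where "(c, \<beta>) \<in> orientations n j l" "(c, \<beta> + \<delta>) \<in> orientations n j l"
    "0 < \<delta>" "\<delta> < \<epsilon>"
proof -
  have X: "X \<subseteq> copies" using assms(1) by (auto simp: substitution_tiling_def tiling_def)
  have inf: "infinite (tile_angle ` X)"
  \<comment> \<open>Finitely many angles would leave an interval \<open>{x..y}\<close> free of
    angles, with frequency 0 instead of the positive \<open>(y - x) / (2 * pi)\<close>.\<close>
  proof
    assume fin: "finite (tile_angle ` X)"
    obtain x y where xy: "0 \<le> x" "x < y" "y < 2 * pi" "{x..y} \<inter> tile_angle ` X = {}"
    proof -
      have "infinite {0<..<2 * pi}" by simp
      hence "infinite ({0<..<2 * pi} - tile_angle ` X)" using fin by simp
      hence "{0<..<2 * pi} - tile_angle ` X \<noteq> {}" by (metis finite.emptyI)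
      moreover have "open ({0<..<2 * pi} - tile_angle ` X)"
        using finite_imp_closed[OF fin] by (intro open_Diff) auto
      ultimately obtain z e where ze: "e > 0" "cball z e \<subseteq> {0<..<2 * pi} - tile_angle ` X"
        by (metis ex_in_conv open_contains_cball)
      hence "{z - e..z + e} \<subseteq> {0<..<2 * pi} - tile_angle ` X" by (simp add: cball_eq_atLeastAtMost)
      moreover have "z - e \<in> {z - e..z + e}" "z + e \<in> {z - e..z + e}" using ze(1) by auto
      ultimately have "z - e \<in> {0<..<2 * pi}" "z + e \<in> {0<..<2 * pi}"
        "{z - e..z + e} \<inter> tile_angle ` X = {}" by blast+
      thus thesis using ze(1) by (intro that[of "z - e" "z + e"]) auto
    qed
    obtain S :: "nat \<Rightarrow> 'm tile" where S: "bij_betw S UNIV X"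
      "\<forall>x y. 0 \<le> x \<and> x < y \<and> y < 2 * pi \<longrightarrow>
         (\<lambda>n. (1 / real n) * (\<Sum>j<n. indicat_real {x..y} (tile_angle (S j))))
           \<longlonglongrightarrow> (y - x) / (2 * pi)"
      using assms(2) unfolding statistical_circular_symmetry_def by blast
    have "S j \<in> X" for j using S(1) by (auto simp: bij_betw_def)
    hence "indicat_real {x..y} (tile_angle (S j)) = 0" for j
      using xy(4) by (auto simp: indicator_def)
    with S(2)[rule_format, of x y] xy have "(\<lambda>n. 0) \<longlonglongrightarrow> (y - x) / (2 * pi)" by simp
    hence "(y - x) / (2 * pi) = 0" by (simp add: LIMSEQ_const_iff)
    thus False using xy by simp
  qed
  \<comment> \<open>One tile is chosen per angle so that the pigeonhole argument runs over angles
    and yields two different ones. The classes \<open>h\<close> record type, chirality and an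
    interval of length \<epsilon>.\<close>
  define f where "f = inv_into X tile_angle"
  have f: "f a \<in> X \<and> tile_angle (f a) = a" if "a \<in> tile_angle ` X" for a
    using that unfolding f_def by (simp add: inv_into_into f_inv_into_f)
  define h where "h a = (tile_type (f a), reflected (f a), \<lfloor>a / \<epsilon>\<rfloor>)" for a
  have "h ` tile_angle ` X \<subseteq> UNIV \<times> UNIV \<times> {0..\<lfloor>2 * pi / \<epsilon>\<rfloor>}"
    using X assms(3) by (auto simp: h_def copies_def subset_iff intro!: floor_mono divide_right_mono)
  hence "finite (h ` tile_angle ` X)" by (rule finite_subset) auto
  with inf obtain a0 where a0: "a0 \<in> tile_angle ` X" "infinite {a \<in> tile_angle ` X. h a = h a0}"
    using pigeonhole_infinite by blast
  from a0(2) have "infinite ({a \<in> tile_angle ` X. h a = h a0} - {a0})" by simp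
  then obtain a1 where a1: "a1 \<in> {a \<in> tile_angle ` X. h a = h a0} - {a0}"
    by (metis ex_in_conv finite.emptyI)
  define a b where "a = min a0 a1" and "b = max a0 a1"
  have ab: "a \<in> tile_angle ` X" "b \<in> tile_angle ` X" "h a = h b" "a < b"
    using a0(1) a1 by (auto simp: a_def b_def min_def max_def)
  have "\<bar>b / \<epsilon> - a / \<epsilon>\<bar> < 1" using ab(3) unfolding h_def by (simp add: floor_eq_iff) linarith
  hence less: "b - a < \<epsilon>" using assms(3) by (simp add: field_simps abs_less_iff)
  have "patch {f a, f b} X" using f ab by (auto simp: patch_def)
  then obtain n i Q where "patch Q (subst_iter lam \<sigma> n i)" "congruent_tiles {f a, f b} Q"
    using assms(1) unfolding substitution_tiling_def by metis
  then obtain c \<beta> s where Q: "act c \<beta> s (f a) \<in> subst_iter lam \<sigma> n i" "act c \<beta> s (f b) \<in> subst_iter lam \<sigma> n i"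
    by (auto simp: patch_def congruent_tiles_act)
  define l d where "l = tile_type (f a)" and "d = (reflected (f a) \<noteq> c)"
  have eq: "tile_type (f b) = l" "(reflected (f b) \<noteq> c) = d" "tile_angle (f a) = a" "tile_angle (f b) = b"
    using ab f unfolding l_def d_def h_def by auto
  have "(d, \<beta> + (if c then - a else a)) \<in> orientations n i l"
    using orientationsI[OF Q(1), of "\<beta> + (if c then - a else a)"] eq
    by (simp add: act_eq l_def d_def)
  moreover have "(d, \<beta> + (if c then - b else b)) \<in> orientations n i l"
    using orientationsI[OF Q(2), of "\<beta> + (if c then - b else b)"] eq
    by (simp add: act_eq)
  \<comment> \<open>An orientation reversing congruence negates both angles, so the smaller one then
    comes from \<open>b\<close>.\<close>
  ultimately show thesis
    using less ab(4) that[of d "\<beta> + a" n i l "b - a"] that[of d "\<beta> - b" n i l "b - a"]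
    by (cases c) auto
qed

text \<open>Primitivity extends the close pair to paths that start and end at the prescribed type
  \<open>i\<close>, as the iteration requires.\<close>

lemma rotations_dense:
  assumes "primitive_substitution \<sigma>" "substitution_tiling T lam \<sigma> X"
    "statistical_circular_symmetry T X" "\<epsilon> > 0"
  obtains M where "\<And>\<phi>. \<exists>\<beta>. (False, \<beta>) \<in> orientations M i i \<and> \<bar>\<beta> - \<phi>\<bar> < \<epsilon>"
proof -
  obtain n j l c \<beta> \<delta> where *: "(c, \<beta>) \<in> orientations n j l" "(c, \<beta> + \<delta>) \<in> orientations n j l"
    and \<delta>: "0 < \<delta>" "\<delta> < \<epsilon>"
    using close_orientations[OF assms(2-4)] .
  obtain k where k: "\<And>i j. (((**) (substitution_matrix \<sigma>) ^^ k) (mat 1)) $ i $ j > 0"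
    using assms(1) by (auto simp: primitive_substitution_def)
  obtain c1 \<beta>1 c2 \<beta>2 where u: "(c1, \<beta>1) \<in> orientations k i j" and v: "(c2, \<beta>2) \<in> orientations k l i"
    using orientations_primitive[OF k] by metis
  \<comment> \<open>If the path leading to the pair reflects, the sign of \<delta> flips and the two
    members exchange roles.\<close>
  have "\<exists>c \<beta>. (c, \<beta>) \<in> orientations (k + (n + k)) i i \<and> (c, \<beta> + \<delta>) \<in> orientations (k + (n + k)) i i"
    using orientations_add[OF u orientations_add[OF *(1) v]]
      orientations_add[OF u orientations_add[OF *(2) v]]
    by (cases c1) (fastforce simp: algebra_simps)+
  then obtain c' \<beta>' where **: "(c', \<beta>') \<in> orientations (k + (n + k)) i i"
    "(c', \<beta>' + \<delta>) \<in> orientations (k + (n + k)) i i" by blast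
  show thesis
  proof (cases c')
    case True
    \<comment> \<open>Products of two reflections turn the pair into rotations with the same difference.\<close>
    have "(False, 0) \<in> orientations (k + (n + k) + (k + (n + k))) i i"
      using orientations_add[OF **(1) **(1)] True by simp
    moreover have "(False, 0 + \<delta>) \<in> orientations (k + (n + k) + (k + (n + k))) i i"
      using orientations_add[OF **(2) **(1)] True by (simp add: add.commute)
    ultimately show thesis using orientations_dense[OF _ _ \<delta>] that by metis
  next
    case False
    thus thesis using ** orientations_dense[OF _ _ \<delta>] that by metis
  qed
qed

section \<open>Placing patches with prescribed chirality and nearly prescribed angle\<close>

text \<open>The patch occurs in a supertile of some type \<open>j\<close>; by primitivity a
  supertile of the prescribed type \<open>i\<close> contains a copy of that one.\<close>

lemma common_supertile:
  assumes "primitive_substitution \<sigma>" "substitution_tiling T lam \<sigma> X" "patch P X"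
  obtains n c \<beta> s where "act c \<beta> s ` P \<subseteq> subst_iter lam \<sigma> n i"
proof -
  obtain m j Q where "patch Q (subst_iter lam \<sigma> m j)" "congruent_tiles P Q"
    using assms(2,3) unfolding substitution_tiling_def by metis
  then obtain c \<beta> s where P: "act c \<beta> s ` P \<subseteq> subst_iter lam \<sigma> m j"
    by (auto simp: patch_def congruent_tiles_act)
  obtain k where k: "\<And>i j. (((**) (substitution_matrix \<sigma>) ^^ k) (mat 1)) $ i $ j > 0"
    using assms(1) by (auto simp: primitive_substitution_def)
  obtain c' \<beta>' where "(c', \<beta>') \<in> orientations k i j"
    using orientations_primitive[OF k] by metis
  from subst_iter_contains[OF this, of m] obtain s' where
    "act c' \<beta>' s' ` subst_iter lam \<sigma> m j \<subseteq> subst_iter lam \<sigma> (k + m) i" .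
  hence "act c' \<beta>' s' ` act c \<beta> s ` P \<subseteq> subst_iter lam \<sigma> (k + m) i" using P by blast
  thus thesis unfolding image_image act_act by (rule that)
qed

text \<open>The two tiles form a patch, which fits into a supertile of type \<open>i\<close>. The
  isometry placing it flips both chiralities or neither, so both occur there at the same
  level.\<close>

lemma both_chiralities:
  assumes "primitive_substitution \<sigma>" "substitution_tiling T lam \<sigma> X"
    and "\<tau> \<in> X" "\<tau>' \<in> X" "tile_type \<tau> = i" "tile_type \<tau>' = i" "reflected \<tau> \<noteq> reflected \<tau>'"
  obtains n where "\<And>c. \<exists>\<beta>. (c, \<beta>) \<in> orientations n i i"
proof -
  have "patch {\<tau>, \<tau>'} X" using assms by (simp add: patch_def)
  then obtain n c \<beta> s where *: "act c \<beta> s ` {\<tau>, \<tau>'} \<subseteq> subst_iter lam \<sigma> n i"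
    using common_supertile[OF assms(1,2)] by metis
  have "\<exists>\<beta>. (reflected \<rho> \<noteq> c, \<beta>) \<in> orientations n i i" if "\<rho> \<in> {\<tau>, \<tau>'}" for \<rho>
  proof -
    have "act c \<beta> s \<rho> \<in> subst_iter lam \<sigma> n i" using * that by blast
    from orientationsI[OF this rmod_copies[OF act_in_copies]] show ?thesis
      using that assms(5,6) by (auto simp: act_eq)
  qed
  from this[of \<tau>] this[of \<tau>'] have "\<exists>\<beta>. (d, \<beta>) \<in> orientations n i i" for d
    using assms(7) by (cases d; cases c; cases "reflected \<tau>") auto
  thus thesis by (rule that)
qed

text \<open>
  The chirality \<open>d\<close> depends on the supertile found near \<open>x\<close> and cannot be prescribed.
\<close>

lemma oriented_copies:
  assumes "primitive_substitution \<sigma>" "substitution_tiling T lam \<sigma> X"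
    and P: "patch P X" "\<tau>0 \<in> P"
    and dense: "\<And>c \<phi>. c \<in> C \<Longrightarrow> \<exists>\<beta>. (c, \<beta>) \<in> orientations M (tile_type \<tau>0) (tile_type \<tau>0) \<and> \<bar>\<beta> - \<phi>\<bar> < \<epsilon>"
  shows "\<exists>r>0. \<forall>x. \<exists>d. \<forall>c\<in>C. \<exists>\<alpha> t. \<bar>\<alpha>\<bar> < \<epsilon> \<and> act (c \<noteq> d) \<alpha> t ` P \<subseteq> X \<and>
           (\<forall>\<tau> \<in> act (c \<noteq> d) \<alpha> t ` P. support T \<tau> \<subseteq> cball x r)"
proof -
  define i where "i = tile_type \<tau>0"
  obtain k where k: "\<And>i j. (((**) (substitution_matrix \<sigma>) ^^ k) (mat 1)) $ i $ j > 0"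
    using assms(1) by (auto simp: primitive_substitution_def)
  obtain n c2 \<beta>2 s2 where P2: "act c2 \<beta>2 s2 ` P \<subseteq> subst_iter lam \<sigma> n i"
    using common_supertile[OF assms(1,2) P(1)] .
  \<comment> \<open>The level is a sum of three stages: \<open>k\<close> steps reach type
    \<open>i\<close> from any supertile, \<open>M\<close> steps adjust the angle, and
    \<open>n\<close> steps produce \<open>P\<close>.\<close>
  obtain r where r: "r > 0" "\<forall>x. \<exists>j c \<beta> s. act c \<beta> s ` subst_iter lam \<sigma> (k + (M + n)) j \<subseteq> X \<and>
       (\<forall>\<tau> \<in> act c \<beta> s ` subst_iter lam \<sigma> (k + (M + n)) j. support T \<tau> \<subseteq> cball x r)"
    using supertile_in_ball[OF assms(2), of "k + (M + n)"] by blast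
  have "\<exists>d. \<forall>c\<in>C. \<exists>\<alpha> t. \<bar>\<alpha>\<bar> < \<epsilon> \<and> act (c \<noteq> d) \<alpha> t ` P \<subseteq> X \<and>
           (\<forall>\<tau> \<in> act (c \<noteq> d) \<alpha> t ` P. support T \<tau> \<subseteq> cball x r)" for x
  proof -
    obtain j c0 \<beta>0 s0 where "act c0 \<beta>0 s0 ` subst_iter lam \<sigma> (k + (M + n)) j \<subseteq> X \<and>
       (\<forall>\<tau> \<in> act c0 \<beta>0 s0 ` subst_iter lam \<sigma> (k + (M + n)) j. support T \<tau> \<subseteq> cball x r)"
      using r(2) by blast
    hence 0: "act c0 \<beta>0 s0 ` subst_iter lam \<sigma> (k + (M + n)) j
        \<subseteq> {\<tau> \<in> X. support T \<tau> \<subseteq> cball x r}"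
      by blast
    obtain c1 \<beta>1 where "(c1, \<beta>1) \<in> orientations k j i"
      using orientations_primitive[OF k] by metis
    from subst_iter_contains[OF this, of "M + n"] obtain s1 where
      1: "act c1 \<beta>1 s1 ` subst_iter lam \<sigma> (M + n) i \<subseteq> subst_iter lam \<sigma> (k + (M + n)) j" .
    define c3 \<beta>3 s3 where "c3 = (c0 \<noteq> c1)" and "\<beta>3 = \<beta>0 + (if c0 then - \<beta>1 else \<beta>1)"
      and "s3 = isom c0 \<beta>0 s0 s1"
    have "act c0 \<beta>0 s0 ` act c1 \<beta>1 s1 ` subst_iter lam \<sigma> (M + n) i \<subseteq> {\<tau> \<in> X. support T \<tau> \<subseteq> cball x r}"
      using 0 1 by blast
    hence 3: "act c3 \<beta>3 s3 ` subst_iter lam \<sigma> (M + n) i \<subseteq> {\<tau> \<in> X. support T \<tau> \<subseteq> cball x r}"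
      unfolding image_image act_act c3_def \<beta>3_def s3_def .
    show ?thesis
    proof (intro exI[of _ "c3 \<noteq> c2"] ballI)
      fix c assume "c \<in> C"
      \<comment> \<open>This target is the value of \<beta> that makes the total angle \<alpha>
        vanish; in general \<alpha> is \<open>\<beta> - \<phi>\<close> up to sign.\<close>
      define \<phi> where "\<phi> = - (if c then - \<beta>2 else \<beta>2) - (if c3 then - \<beta>3 else \<beta>3)"
      obtain \<beta> where \<beta>: "(c, \<beta>) \<in> orientations M i i" "\<bar>\<beta> - \<phi>\<bar> < \<epsilon>"
        using dense[OF \<open>c \<in> C\<close>] unfolding i_def by blast
      from subst_iter_contains[OF \<beta>(1), of n] obtain s where
        4: "act c \<beta> s ` subst_iter lam \<sigma> n i \<subseteq> subst_iter lam \<sigma> (M + n) i" .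
      define \<alpha> t where
        "\<alpha> = \<beta>3 + (if c3 then - (\<beta> + (if c then - \<beta>2 else \<beta>2)) else \<beta> + (if c then - \<beta>2 else \<beta>2))"
        and "t = isom c3 \<beta>3 s3 (isom c \<beta> s s2)"
      have "act c3 \<beta>3 s3 ` act c \<beta> s ` act c2 \<beta>2 s2 ` P \<subseteq> {\<tau> \<in> X. support T \<tau> \<subseteq> cball x r}"
        using 3 4 P2 by blast
      hence "act (c3 \<noteq> (c \<noteq> c2)) \<alpha> t ` P \<subseteq> {\<tau> \<in> X. support T \<tau> \<subseteq> cball x r}"
        unfolding image_image act_act \<alpha>_def t_def .
      moreover have "(c3 \<noteq> (c \<noteq> c2)) = (c \<noteq> (c3 \<noteq> c2))" by auto
      moreover have "\<bar>\<alpha>\<bar> < \<epsilon>" using \<beta>(2) unfolding \<alpha>_def \<phi>_def by (auto split: if_splits)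
      ultimately show "\<exists>\<alpha> t. \<bar>\<alpha>\<bar> < \<epsilon> \<and> act (c \<noteq> (c3 \<noteq> c2)) \<alpha> t ` P \<subseteq> X \<and>
           (\<forall>\<tau> \<in> act (c \<noteq> (c3 \<noteq> c2)) \<alpha> t ` P. support T \<tau> \<subseteq> cball x r)"
        by (intro exI[of _ \<alpha>] exI[of _ t]) auto
    qed
  qed
  with r(1) show ?thesis by blast
qed

lemma repetitive_up_to_small_rotation:
  assumes prim: "primitive_substitution \<sigma>" and X: "substitution_tiling T lam \<sigma> X"
    and sym: "statistical_circular_symmetry T X" and \<epsilon>: "\<epsilon> > 0" and P: "patch P X"
  shows "\<exists>r>0. \<forall>x. \<exists>\<alpha> t. \<bar>\<alpha>\<bar> < \<epsilon> \<and> move \<alpha> t ` P \<subseteq> X \<and>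
           (\<forall>\<tau> \<in> move \<alpha> t ` P. support T \<tau> \<subseteq> cball x r)"
proof (cases "P = {}")
  case True
  \<comment> \<open>The empty patch has no tile \<open>\<tau>0\<close> to supply a type, but any
    ball and angle 0 will do.\<close>
  thus ?thesis using \<epsilon> by (intro exI[of _ 1]) (auto intro: exI[of _ 0])
next
  case False
  then obtain \<tau>0 where \<tau>0: "\<tau>0 \<in> P" by blast
  define i where "i = tile_type \<tau>0"
  have act_move: "act False \<alpha> t = (move \<alpha> t :: 'm tile \<Rightarrow> 'm tile)" for \<alpha> t
    by (auto simp: act_def)
  obtain M where M: "\<And>\<phi>. \<exists>\<beta>. (False, \<beta>) \<in> orientations M i i \<and> \<bar>\<beta> - \<phi>\<bar> < \<epsilon>"
    using rotations_dense[OF prim X sym \<epsilon>, of i] by blast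
  show ?thesis
  proof (cases "\<exists>\<tau>\<in>X. \<exists>\<tau>'\<in>X. tile_type \<tau> = i \<and> tile_type \<tau>' = i \<and> reflected \<tau> \<noteq> reflected \<tau>'")
    case True
    then obtain \<tau> \<tau>' where \<tau>: "\<tau> \<in> X" "\<tau>' \<in> X" "tile_type \<tau> = i" "tile_type \<tau>' = i"
      "reflected \<tau> \<noteq> reflected \<tau>'" by blast
    obtain m where m: "\<And>c. \<exists>\<beta>. (c, \<beta>) \<in> orientations m i i"
      using both_chiralities[OF prim X \<tau>] by blast
    \<comment> \<open>Following a dense set of rotations by one fixed orientation of chirality
      \<open>c\<close> keeps the angles dense.\<close>
    have "\<exists>\<beta>. (c, \<beta>) \<in> orientations (M + m) i i \<and> \<bar>\<beta> - \<phi>\<bar> < \<epsilon>" for c \<phi>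
    proof -
      obtain \<gamma> where \<gamma>: "(c, \<gamma>) \<in> orientations m i i" using m by blast
      obtain \<beta> where \<beta>: "(False, \<beta>) \<in> orientations M i i" "\<bar>\<beta> - (\<phi> - \<gamma>)\<bar> < \<epsilon>" using M by blast
      show ?thesis using orientations_add[OF \<beta>(1) \<gamma>] \<beta>(2)
        by (intro exI[of _ "\<beta> + \<gamma>"]) (auto simp: algebra_simps)
    qed
    from oriented_copies[OF prim X P \<tau>0, of UNIV "M + m" \<epsilon>, folded i_def, OF this]
    obtain r where r: "r > 0 \<and> (\<forall>x. \<exists>d. \<forall>c\<in>(UNIV :: bool set). \<exists>\<alpha> t. \<bar>\<alpha>\<bar> < \<epsilon> \<and> act (c \<noteq> d) \<alpha> t ` P \<subseteq> X \<and>
           (\<forall>\<tau> \<in> act (c \<noteq> d) \<alpha> t ` P. support T \<tau> \<subseteq> cball x r))" by blast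
    show ?thesis
    proof (rule exI[of _ r], intro conjI allI conjunct1[OF r])
      fix x
      obtain d where "\<forall>c\<in>(UNIV :: bool set). \<exists>\<alpha> t. \<bar>\<alpha>\<bar> < \<epsilon> \<and> act (c \<noteq> d) \<alpha> t ` P \<subseteq> X \<and>
           (\<forall>\<tau> \<in> act (c \<noteq> d) \<alpha> t ` P. support T \<tau> \<subseteq> cball x r)"
        using spec[OF conjunct2[OF r]] by blast
      \<comment> \<open>Choosing \<open>c\<close> equal to the uncontrolled \<open>d\<close> makes
        the total placement orientation preserving.\<close>
      from bspec[OF this UNIV_I, of d] show "\<exists>\<alpha> t. \<bar>\<alpha>\<bar> < \<epsilon> \<and> move \<alpha> t ` P \<subseteq> X \<and>
           (\<forall>\<tau> \<in> move \<alpha> t ` P. support T \<tau> \<subseteq> cball x r)" by (simp add: act_move)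
    qed
  next
    case False
    have "\<exists>\<beta>. (c, \<beta>) \<in> orientations M i i \<and> \<bar>\<beta> - \<phi>\<bar> < \<epsilon>" if "c \<in> {False}" for c \<phi>
      using M that by auto
    from oriented_copies[OF prim X P \<tau>0, of "{False}" M \<epsilon>, folded i_def, OF this]
    obtain r where r: "r > 0" "\<forall>x. \<exists>d. \<exists>\<alpha> t. \<bar>\<alpha>\<bar> < \<epsilon> \<and> act d \<alpha> t ` P \<subseteq> X \<and>
           (\<forall>\<tau> \<in> act d \<alpha> t ` P. support T \<tau> \<subseteq> cball x r)" by auto
    \<comment> \<open>The tile \<open>\<tau>0\<close> and its image both lie in \<open>X\<close> and
      have type \<open>i\<close>, of which only one chirality occurs; hence the placement cannot
      reflect.\<close>
    have unreflected: "d = False" if "act d \<alpha> t ` P \<subseteq> X" for d \<alpha> t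
    proof -
      have "act d \<alpha> t \<tau>0 \<in> X" "\<tau>0 \<in> X" using that \<tau>0 P by (auto simp: patch_def)
      moreover have "tile_type (act d \<alpha> t \<tau>0) = i" by (simp add: act_eq i_def)
      ultimately have "reflected (act d \<alpha> t \<tau>0) = reflected \<tau>0"
        using False i_def by metis
      thus ?thesis by (auto simp: act_eq)
    qed
    show ?thesis
    proof (rule exI[of _ r], intro conjI allI r(1))
      fix x
      obtain d \<alpha> t where *: "\<bar>\<alpha>\<bar> < \<epsilon>" "act d \<alpha> t ` P \<subseteq> X"
        "\<forall>\<tau> \<in> act d \<alpha> t ` P. support T \<tau> \<subseteq> cball x r" using r(2) by blast
      with unreflected[OF *(2)] show "\<exists>\<alpha> t. \<bar>\<alpha>\<bar> < \<epsilon> \<and> move \<alpha> t ` P \<subseteq> X \<and>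
           (\<forall>\<tau> \<in> move \<alpha> t ` P. support T \<tau> \<subseteq> cball x r)"
        unfolding act_move[symmetric] by blast
    qed
  qed
qed

end

theorem theorem6p3:
  fixes T :: "'m::finite \<Rightarrow> complex set"
    and lam :: real
    and \<sigma> :: "'m \<Rightarrow> 'm tile set"
    and X P :: "'m tile set"
    and \<epsilon> :: real
  assumes "prototiles T"
    and "self_similar_substitution T lam \<sigma>"
    and "primitive_substitution \<sigma>"
    and "substitution_tiling T lam \<sigma> X"
    and "statistical_circular_symmetry T X"
    and "\<epsilon> > 0"
    and "patch P X"
  shows "\<exists>r>0. \<forall>x. \<exists>\<alpha> t. \<bar>\<alpha>\<bar> < \<epsilon> \<and> move \<alpha> t ` P \<subseteq> X \<and>
           (\<forall>\<tau> \<in> move \<alpha> t ` P. support T \<tau> \<subseteq> cball x r)"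
proof -
  interpret substitution T lam \<sigma>
    using assms(1,2) by unfold_locales
  show ?thesis
    using assms(3-7) by (rule repetitive_up_to_small_rotation)
qed

end
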